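(* Let $\mathcal S$ be an induced system, let $(\overline\delta_C:C\in\mathcal S)$ together with vertices $(v_C:C\in\mathcal S)$ be a starring of $\mathcal S$, and let $\overline\delta$ be a linearization of this starring. Then the map $v_C\mapsto C$ is an isomorphism of simplicial complexes from $\overline\delta(U_{\mathcal S})$ onto the chain complex $\mathcal C(P_{\mathcal S})$.
   Context: Complexes, $[\sigma]$, $\partial[\sigma]$, joins (with $A\star\emptyset=\emptyset$), links, and stellar moves are as follows: for a finite set $\sigma$, $[\sigma]$ is the complex of non-empty subsets, $\partial[\sigma]=[\sigma]\setminus\{\sigma\}$; $A\star B=A\cup B\cup\{\sigma\cup\tau:\sigma\in A,\tau\in B\}$ for disjoint domains (and $\emptyset$ if one is empty); $\mathrm{st}(\sigma,A)=\{\tau\in A:\sigma\subseteq\tau\}$, $\mathrm{lk}(\sigma,A)=\{\tau\in A:\tau\cap\sigma=\emptyset,\ \sigma\cup\tau\in A\}$; the subdivision $(\sigma,a)A=(A\setminus\mathrm{st}(\sigma,A))\cup([\{a\}]\star\partial[\sigma]\star\mathrm{lk}(\sigma,A))$ if $\sigma\in A$, $a\notin\mathrm{dom}(A)$, else $A$; the weld $(\sigma,a)^{-1}A=(A\setminus\mathrm{st}(\{a\},A))\cup([\sigma]\star L)$ if $\sigma\notin A$, $a\in\mathrm{dom}(A)$, $\mathrm{lk}(\{a\},A)=\partial[\sigma]\star L$ for some complex $L$, else $A$. Such a move is based on $\sigma$ and has vertex $a$. Applying a finite sequence of moves to a complex means applying its entries in order, first entry first. A system is a collection $\mathcal S$ of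 non-empty complexes such that $C_1\cap C_2\in\mathcal S$ whenever $C_1,C_2\in\mathcal S$ and $C_1\cap C_2\ne\emptyset$. $U_{\mathcal S}=\bigcup\mathcal S$; $P_{\mathcal S}=(\mathcal S,\subseteq)$; $\mathcal C(P_{\mathcal S})$ is the complex of all non-empty finite chains of $P_{\mathcal S}$; $D_{\mathcal S}(C)=\bigcup\{C'\in\mathcal S:C'\subsetneq C\}$. $\mathcal S$ is induced if for each $C\in\mathcal S$, $\sigma\subseteq\mathrm{dom}(C)$ and $\sigma\in U_{\mathcal S}$ imply $\sigma\in C$. A move based on $\sigma$ with vertex $a$ is concentrated on $C\in\mathcal S$ if $([\{a\}]\star[\sigma])\cap U_{\mathcal S}\subseteq C$, $a\notin\mathrm{dom}(D_{\mathcal S}(C))$ and $\sigma\not\subseteq\mathrm{dom}(D_{\mathcal S}(C))$; a sequence is concentrated on $C$ if each entry is. For moves $\delta$ (vertex $a$) and $\delta'$ (based on $\sigma'$, vertex $a'$), $\delta'$ is free from $\delta$ if $\delta$ is a weld, or $a\ne a'$ and $a\notin\sigma'$. A starring of $\mathcal S$ is a family of finite sequences of moves $(\overline\delta_C:C\in\mathcal S)$ together with elements $v_C$ ($C\in\mathcal S$) such that: $\overline\delta_C$ is concentrated on $C$; $\overline\delta_C(C)=[\{v_C\}]\star D_{\mathcal S}(C)$; $v_C\notin\mathrm{dom}(C)$ and $v_C\ne v_{C'}$ for $C\ne C'$; if $C\not\subseteq C'$ then every entry of $\overline\delta_{C'}$ is free from every entry of $\overline\delta_C$. A linearization is a concatenation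 $\overline\delta_{C_1}\cdots\overline\delta_{C_m}$ (listing each $C\in\mathcal S$ exactly once) such that $C_i\subsetneq C_j$ implies $j<i$.
   Formalization: The join convention is A⋆∅ = A instead of A⋆∅ = ∅ (under which a one-complex system is starred to ∅ and the claim fails), and a weld based on a one-element set, ill-defined as given, is taken to leave the complex unchanged. *)

theory Defs
  imports Main
begin

text \<open>Complexes are families of non-empty finite sets; the empty face is never included.\<close>

definition complex :: "'a set set \<Rightarrow> bool" where
  "complex A \<longleftrightarrow>
     (\<forall>\<sigma>\<in>A. finite \<sigma> \<and> \<sigma> \<noteq> {}) \<and> (\<forall>\<sigma>\<in>A. \<forall>\<tau>. \<tau> \<subseteq> \<sigma> \<and> \<tau> \<noteq> {} \<longrightarrow> \<tau> \<in> A)"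

abbreviation (input) vdom :: "'a set set \<Rightarrow> 'a set" where
  "vdom A \<equiv> \<Union>A"

definition simplex :: "'a set \<Rightarrow> 'a set set" where
  "simplex \<sigma> = {\<tau>. \<tau> \<subseteq> \<sigma> \<and> \<tau> \<noteq> {}}"

definition bdry :: "'a set \<Rightarrow> 'a set set" where
  "bdry \<sigma> = simplex \<sigma> - {\<sigma>}"

text \<open>
  The formula gives the empty complex the role of a unit, \<open>A \<star> {} = A\<close>. Since faces are non-empty,
  this is what makes the link of a facet, the boundary of a vertex, or \<open>lower S C\<close> for a minimal
  \<open>C\<close> (all of them empty) contribute to a join in the usual way. With \<open>A \<star> {} = {}\<close> instead,
  subdividing a facet would merely delete it, and a one-element system would be starred to
  the empty complex.
\<close>

definition join :: "'a set set \<Rightarrow> 'a set set \<Rightarrow> 'a set set"  (infixl "\<star>" 65) where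
  "A \<star> B = A \<union> B \<union> {\<sigma> \<union> \<tau> | \<sigma> \<tau>. \<sigma> \<in> A \<and> \<tau> \<in> B}"

definition star :: "'a set \<Rightarrow> 'a set set \<Rightarrow> 'a set set" where
  "star \<sigma> A = {\<tau> \<in> A. \<sigma> \<subseteq> \<tau>}"

definition link :: "'a set \<Rightarrow> 'a set set \<Rightarrow> 'a set set" where
  "link \<sigma> A = {\<tau> \<in> A. \<tau> \<inter> \<sigma> = {} \<and> \<sigma> \<union> \<tau> \<in> A}"

definition subdivide :: "'a set \<Rightarrow> 'a \<Rightarrow> 'a set set \<Rightarrow> 'a set set" where
  "subdivide \<sigma> a A =
     (if \<sigma> \<in> A \<and> a \<notin> vdom A
      then (A - star \<sigma> A) \<union> (simplex {a} \<star> bdry \<sigma> \<star> link \<sigma> A)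
      else A)"

definition weld_factor :: "'a set \<Rightarrow> 'a \<Rightarrow> 'a set set \<Rightarrow> 'a set set \<Rightarrow> bool" where
  "weld_factor \<sigma> a A L \<longleftrightarrow>
     complex L \<and> vdom (bdry \<sigma>) \<inter> vdom L = {} \<and> link {a} A = bdry \<sigma> \<star> L"

lemma weld_factor_unique:
  assumes "weld_factor \<sigma> a A L"
  shows "L = {\<tau> \<in> link {a} A. \<tau> \<inter> vdom (bdry \<sigma>) = {}}"
proof -
  have disj: "\<And>\<tau>. \<tau> \<in> L \<Longrightarrow> \<tau> \<inter> vdom (bdry \<sigma>) = {}"
    and lk: "link {a} A = bdry \<sigma> \<star> L"
    using assms unfolding weld_factor_def by blast+
  have meet: "\<tau> \<inter> vdom (bdry \<sigma>) \<noteq> {}" if "\<rho> \<in> bdry \<sigma>" "\<rho> \<subseteq> \<tau>" for \<rho> \<tau>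
  proof -
    from \<open>\<rho> \<in> bdry \<sigma>\<close> obtain x where "x \<in> \<rho>"
      by (auto simp: bdry_def simplex_def)
    with that show ?thesis by blast
  qed
  show ?thesis
  proof (intro equalityI subsetI)
    fix \<tau> assume "\<tau> \<in> L"
    then show "\<tau> \<in> {\<tau> \<in> link {a} A. \<tau> \<inter> vdom (bdry \<sigma>) = {}}"
      using disj by (simp add: lk join_def)
  next
    fix \<tau> assume "\<tau> \<in> {\<tau> \<in> link {a} A. \<tau> \<inter> vdom (bdry \<sigma>) = {}}"
    then have "\<tau> \<in> bdry \<sigma> \<star> L" and e: "\<tau> \<inter> vdom (bdry \<sigma>) = {}"
      by (simp_all add: lk)
    then consider "\<tau> \<in> bdry \<sigma>" | "\<tau> \<in> L" | \<rho> \<mu> where "\<tau> = \<rho> \<union> \<mu>" "\<rho> \<in> bdry \<sigma>"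
      unfolding join_def by fast
    then show "\<tau> \<in> L"
    proof cases
      case 1
      then show ?thesis using meet[of \<tau> \<tau>] e by simp
    next
      case 3
      then show ?thesis using meet[of \<rho> \<tau>] e by simp
    qed
  qed
qed

text \<open>
  A weld is effective only if \<open>bdry \<sigma>\<close> is non-empty, i.e. \<open>\<sigma>\<close> has at least two elements. A weld
  based on \<open>{s}\<close> would just rename \<open>a\<close> to \<open>s\<close>, which is the subdivision based on \<open>{a}\<close> with
  vertex \<open>s\<close>. It would be the only kind of weld that creates a new vertex, whereas freeness below
  treats welds as never creating one.
\<close>

definition weld :: "'a set \<Rightarrow> 'a \<Rightarrow> 'a set set \<Rightarrow> 'a set set" where
  "weld \<sigma> a A =
     (if \<sigma> \<notin> A \<and> a \<in> vdom A \<and> bdry \<sigma> \<noteq> {} \<and> (\<exists>L. weld_factor \<sigma> a A L)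
      then (A - star {a} A) \<union> (simplex \<sigma> \<star> (THE L. weld_factor \<sigma> a A L))
      else A)"

datatype 'a move =
    is_Subdivision: Subdivision (base: "'a set") (vertex: 'a)
  | is_Weld: Weld (base: "'a set") (vertex: 'a)

fun apply_move :: "'a move \<Rightarrow> 'a set set \<Rightarrow> 'a set set" where
  "apply_move (Subdivision \<sigma> a) A = subdivide \<sigma> a A"
| "apply_move (Weld \<sigma> a) A = weld \<sigma> a A"

definition apply_moves :: "'a move list \<Rightarrow> 'a set set \<Rightarrow> 'a set set" where
  "apply_moves ds A = fold apply_move ds A"

definition system :: "'a set set set \<Rightarrow> bool" where
  "system S \<longleftrightarrow>
     (\<forall>C\<in>S. complex C \<and> C \<noteq> {}) \<and>
     (\<forall>C1\<in>S. \<forall>C2\<in>S. C1 \<inter> C2 \<noteq> {} \<longrightarrow> C1 \<inter> C2 \<in> S)"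

definition lower :: "'a set set set \<Rightarrow> 'a set set \<Rightarrow> 'a set set" where
  "lower S C = \<Union>{C' \<in> S. C' \<subset> C}"

definition induced :: "'a set set set \<Rightarrow> bool" where
  "induced S \<longleftrightarrow> (\<forall>C\<in>S. \<forall>\<sigma>. \<sigma> \<subseteq> vdom C \<and> \<sigma> \<in> \<Union>S \<longrightarrow> \<sigma> \<in> C)"

definition chain_complex :: "'a set set set \<Rightarrow> 'a set set set set" where
  "chain_complex S = {K. K \<noteq> {} \<and> finite K \<and> subset.chain S K}"

definition concentrated :: "'a set set set \<Rightarrow> 'a set set \<Rightarrow> 'a move \<Rightarrow> bool" where
  "concentrated S C d \<longleftrightarrow>
     (simplex {vertex d} \<star> simplex (base d)) \<inter> \<Union>S \<subseteq> C \<and>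
     vertex d \<notin> vdom (lower S C) \<and>
     \<not> base d \<subseteq> vdom (lower S C)"

text \<open>\<open>free_from d' d\<close>: the move \<open>d'\<close> is free from the move \<open>d\<close>.\<close>

definition free_from :: "'a move \<Rightarrow> 'a move \<Rightarrow> bool" where
  "free_from d' d \<longleftrightarrow> is_Weld d \<or> vertex d \<noteq> vertex d' \<and> vertex d \<notin> base d'"

definition starring ::
    "'a set set set \<Rightarrow> ('a set set \<Rightarrow> 'a move list) \<Rightarrow> ('a set set \<Rightarrow> 'a) \<Rightarrow> bool" where
  "starring S \<delta> v \<longleftrightarrow>
     (\<forall>C\<in>S. \<forall>d\<in>set (\<delta> C). finite (base d) \<and> concentrated S C d) \<and>
     (\<forall>C\<in>S. apply_moves (\<delta> C) C = simplex {v C} \<star> lower S C) \<and>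
     (\<forall>C\<in>S. v C \<notin> vdom C) \<and>
     (\<forall>C\<in>S. \<forall>C'\<in>S. C \<noteq> C' \<longrightarrow> v C \<noteq> v C') \<and>
     (\<forall>C\<in>S. \<forall>C'\<in>S. \<not> C \<subseteq> C' \<longrightarrow>
        (\<forall>d'\<in>set (\<delta> C'). \<forall>d\<in>set (\<delta> C). free_from d' d))"

definition linearization ::
    "'a set set set \<Rightarrow> ('a set set \<Rightarrow> 'a move list) \<Rightarrow> 'a move list \<Rightarrow> bool" where
  "linearization S \<delta> ds \<longleftrightarrow>
     (\<exists>Cs. distinct Cs \<and> set Cs = S \<and>
        (\<forall>i<length Cs. \<forall>j<length Cs. Cs ! i \<subset> Cs ! j \<longrightarrow> j < i) \<and>
        ds = concat (map \<delta> Cs))"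

definition complex_iso :: "('a \<Rightarrow> 'b) \<Rightarrow> 'a set set \<Rightarrow> 'b set set \<Rightarrow> bool" where
  "complex_iso f A B \<longleftrightarrow>
     bij_betw f (vdom A) (vdom B) \<and> (\<forall>\<sigma>. \<sigma> \<subseteq> vdom A \<longrightarrow> (\<sigma> \<in> A \<longleftrightarrow> f ` \<sigma> \<in> B))"

end

theory Submission
  imports Defs
begin

text \<open>
  Process the system from the top down. When the complexes still to be processed form the set \<open>T\<close>,
  the current complex consists of the faces \<open>\<sigma> \<union> v ` K\<close>, where \<open>K\<close> is a chain of processed
  complexes and \<open>\<sigma>\<close> is empty or a face of a member of \<open>T\<close> lying below all of \<open>K\<close>. If \<open>C\<close> is
  maximal in \<open>T\<close>, this complex has the form \<open>(C \<star> M) \<union> B\<close>, where \<open>M\<close> is spanned by the chains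
  strictly above \<open>C\<close> and \<open>B\<close> does not involve \<open>C\<close>. Concentration keeps the moves of \<open>\<delta> C\<close> away
  from \<open>B\<close>, and freeness keeps them away from the vertices of \<open>M\<close>, so they transform it into
  \<open>(\<delta> C (C) \<star> M) \<union> B\<close>, which is the complex belonging to \<open>T - {C}\<close>. In the end \<open>T\<close> is empty and
  only the sets \<open>v ` K\<close> remain.
\<close>

section \<open>Moves on complexes\<close>

lemma complexD:
  assumes "complex A" "\<sigma> \<in> A" "\<tau> \<subseteq> \<sigma>" "\<tau> \<noteq> {}"
  shows "\<tau> \<in> A"
  using assms unfolding complex_def by blast

lemma empty_notin_complex: "complex A \<Longrightarrow> {} \<notin> A"
  unfolding complex_def by blast

text \<open>Allowing an empty part in either factor merges the three kinds of faces of a join into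
  one; only the empty union has to be excluded.\<close>

lemma in_join_iff:
  assumes "{} \<notin> A" "{} \<notin> B"
  shows "\<tau> \<in> A \<star> B \<longleftrightarrow> \<tau> \<noteq> {} \<and> (\<exists>\<rho>\<in>insert {} A. \<exists>\<mu>\<in>insert {} B. \<tau> = \<rho> \<union> \<mu>)"
  using assms unfolding join_def by auto

text \<open>Splitting a face along the vertex set of one factor makes membership in a join pointwise.\<close>

lemma in_join_iff_split:
  assumes "{} \<notin> A" "{} \<notin> B" "\<Union>B \<subseteq> V" "\<Union>A \<inter> V = {}"
  shows "\<tau> \<in> A \<star> B \<longleftrightarrow> \<tau> \<noteq> {} \<and> \<tau> - V \<in> insert {} A \<and> \<tau> \<inter> V \<in> insert {} B"
proof -
  have "\<tau> - V = \<rho> \<and> \<tau> \<inter> V = \<mu>" if "\<rho> \<in> insert {} A" "\<mu> \<in> insert {} B" "\<tau> = \<rho> \<union> \<mu>" for \<rho> \<mu>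
    using that assms(3,4) by blast
  moreover have "\<tau> = (\<tau> - V) \<union> (\<tau> \<inter> V)" by blast
  ultimately show ?thesis
    unfolding in_join_iff[OF assms(1,2)] by metis
qed

lemma Union_join: "\<Union>(A \<star> B) = \<Union>A \<union> \<Union>B"
  unfolding join_def by blast

lemma join_assoc: "(A \<star> B) \<star> C = A \<star> (B \<star> C)"
proof (intro equalityI subsetI)
  fix \<tau> assume "\<tau> \<in> (A \<star> B) \<star> C"
  then show "\<tau> \<in> A \<star> (B \<star> C)" unfolding join_def by (auto simp: Un_assoc)
next
  fix \<tau> assume "\<tau> \<in> A \<star> (B \<star> C)"
  then show "\<tau> \<in> (A \<star> B) \<star> C" unfolding join_def by (auto simp: Un_assoc[symmetric]) blast+
qed

lemma join_Un_left: "(A \<union> A') \<star> B = (A \<star> B) \<union> (A' \<star> B)"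
  unfolding join_def by blast

section \<open>Operations and moves that preserve complexes\<close>

lemma complex_join:
  assumes "complex A" "complex B"
  shows "complex (A \<star> B)"
proof -
  have ne: "{} \<notin> A" "{} \<notin> B" using assms by (auto dest: empty_notin_complex)
  have "\<tau> \<in> A \<star> B" if "\<sigma> \<in> A \<star> B" "\<tau> \<subseteq> \<sigma>" "\<tau> \<noteq> {}" for \<sigma> \<tau>
  proof -
    from that(1) obtain \<rho> \<mu> where *: "\<rho> \<in> insert {} A" "\<mu> \<in> insert {} B" "\<sigma> = \<rho> \<union> \<mu>"
      unfolding in_join_iff[OF ne] by blast
    have "\<tau> \<inter> \<rho> \<in> insert {} A" "\<tau> \<inter> \<mu> \<in> insert {} B"
      using * complexD[OF assms(1)] complexD[OF assms(2)] by (metis Int_empty_right inf_le2 insert_iff)+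
    moreover have "\<tau> = (\<tau> \<inter> \<rho>) \<union> (\<tau> \<inter> \<mu>)" using that(2) * by blast
    ultimately show ?thesis unfolding in_join_iff[OF ne] using that(3) by blast
  qed
  moreover have "finite \<sigma> \<and> \<sigma> \<noteq> {}" if "\<sigma> \<in> A \<star> B" for \<sigma>
    using that assms unfolding join_def complex_def by auto
  ultimately show ?thesis unfolding complex_def by blast
qed

lemma complex_Un:
  assumes "complex A" "complex B"
  shows "complex (A \<union> B)"
proof -
  have "\<tau> \<in> A \<union> B" if "\<sigma> \<in> A \<union> B" "\<tau> \<subseteq> \<sigma>" "\<tau> \<noteq> {}" for \<sigma> \<tau>
    using that complexD[OF assms(1), of \<sigma> \<tau>] complexD[OF assms(2), of \<sigma> \<tau>] by auto
  moreover have "finite \<sigma> \<and> \<sigma> \<noteq> {}" if "\<sigma> \<in> A \<union> B" for \<sigma>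
    using that assms unfolding complex_def by auto
  ultimately show ?thesis unfolding complex_def by simp
qed

lemma complex_simplex: "finite \<sigma> \<Longrightarrow> complex (simplex \<sigma>)"
  unfolding complex_def simplex_def by (auto intro: finite_subset)

lemma complex_bdry: "finite \<sigma> \<Longrightarrow> complex (bdry \<sigma>)"
  unfolding complex_def bdry_def simplex_def by (auto intro: finite_subset)

lemma complex_link:
  assumes "complex A"
  shows "complex (link \<sigma> A)"
proof -
  have "\<tau>' \<in> link \<sigma> A" if "\<tau> \<in> link \<sigma> A" "\<tau>' \<subseteq> \<tau>" "\<tau>' \<noteq> {}" for \<tau> \<tau>'
  proof -
    have "\<tau> \<in> A" "\<tau> \<inter> \<sigma> = {}" "\<sigma> \<union> \<tau> \<in> A" using that unfolding link_def by auto
    moreover have "\<sigma> \<union> \<tau>' \<subseteq> \<sigma> \<union> \<tau>" "\<sigma> \<union> \<tau>' \<noteq> {}" using that by auto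
    ultimately show ?thesis using complexD[OF assms] that unfolding link_def by blast
  qed
  moreover have "finite \<tau> \<and> \<tau> \<noteq> {}" if "\<tau> \<in> link \<sigma> A" for \<tau>
    using that assms unfolding link_def complex_def by auto
  ultimately show ?thesis unfolding complex_def by blast
qed

lemma complex_diff_star:
  assumes "complex A"
  shows "complex (A - star \<sigma> A)"
proof -
  have "A - star \<sigma> A = {\<tau> \<in> A. \<not> \<sigma> \<subseteq> \<tau>}" unfolding star_def by blast
  moreover have "\<not> \<sigma> \<subseteq> \<tau>'" if "\<not> \<sigma> \<subseteq> \<tau>" "\<tau>' \<subseteq> \<tau>" for \<tau> \<tau>'
    using that by blast
  ultimately show ?thesis using assms unfolding complex_def by (simp, meson)
qed

lemma weld_eq:
  assumes "\<sigma> \<notin> A" "a \<in> \<Union>A" "bdry \<sigma> \<noteq> {}" "weld_factor \<sigma> a A L"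
  shows "weld \<sigma> a A = (A - star {a} A) \<union> (simplex \<sigma> \<star> L)"
proof -
  have "(THE L. weld_factor \<sigma> a A L) = L"
    using assms(4) weld_factor_unique by (metis (mono_tags, lifting) the_equality)
  then show ?thesis using assms unfolding weld_def by auto
qed

text \<open>Separates the idle weld from the effective one and names the link factor of the latter,
  so that no definite description is left.\<close>

lemma weld_cases:
  obtains "weld \<sigma> a A = A"
  | L where "\<sigma> \<notin> A" "a \<in> \<Union>A" "bdry \<sigma> \<noteq> {}" "weld_factor \<sigma> a A L"
      "weld \<sigma> a A = (A - star {a} A) \<union> (simplex \<sigma> \<star> L)"
proof (cases "\<sigma> \<notin> A \<and> a \<in> \<Union>A \<and> bdry \<sigma> \<noteq> {} \<and> (\<exists>L. weld_factor \<sigma> a A L)")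
  case True
  then obtain L where L: "\<sigma> \<notin> A" "a \<in> \<Union>A" "bdry \<sigma> \<noteq> {}" "weld_factor \<sigma> a A L" by blast
  show ?thesis by (rule that(2)[OF L weld_eq[OF L]])
next
  case False
  then show ?thesis by (intro that(1)) (simp only: weld_def if_False)
qed

lemma complex_apply_move:
  assumes "complex A" "finite (base d)"
  shows "complex (apply_move d A)"
proof (cases d)
  case (Subdivision \<sigma> a)
  have "complex ((A - star \<sigma> A) \<union> (simplex {a} \<star> bdry \<sigma> \<star> link \<sigma> A))"
    using assms Subdivision
    by (intro complex_Un complex_join complex_diff_star complex_simplex complex_bdry complex_link) auto
  then show ?thesis using assms Subdivision by (simp add: subdivide_def)
next
  case (Weld \<sigma> a)
  show ?thesis
  proof (cases rule: weld_cases[of \<sigma> a A])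
    case 1
    then show ?thesis using assms Weld by simp
  next
    case (2 L)
    have "complex ((A - star {a} A) \<union> (simplex \<sigma> \<star> L))"
      using 2 assms Weld
      by (intro complex_Un complex_join complex_diff_star complex_simplex) (auto simp: weld_factor_def)
    then show ?thesis using 2 Weld by simp
  qed
qed

section \<open>Vertex sets and the vertices that moves create\<close>

lemma Union_simplex: "\<Union>(simplex \<sigma>) = \<sigma>"
  unfolding simplex_def by auto

lemma Union_bdry_subset: "\<Union>(bdry \<sigma>) \<subseteq> \<sigma>"
  unfolding bdry_def simplex_def by auto

text \<open>A non-empty boundary forces at least two elements in \<open>\<sigma>\<close>, so each of
  its singletons is a proper face.\<close>

lemma Union_bdry:
  assumes "bdry \<sigma> \<noteq> {}"
  shows "\<Union>(bdry \<sigma>) = \<sigma>"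
proof -
  from assms obtain \<tau> where "\<tau> \<subset> \<sigma>" "\<tau> \<noteq> {}" unfolding bdry_def simplex_def by auto
  then have "{x} \<in> bdry \<sigma>" if "x \<in> \<sigma>" for x
    using that unfolding bdry_def simplex_def by auto
  then show ?thesis using Union_bdry_subset by fastforce
qed

lemma Union_subdivide: "\<Union>(subdivide \<sigma> a A) \<subseteq> insert a (\<Union>A)"
proof -
  have "\<Union>(link \<sigma> A) \<subseteq> \<Union>A" unfolding link_def by blast
  moreover have "\<Union>(bdry \<sigma>) \<subseteq> \<Union>A" if "\<sigma> \<in> A" using Union_bdry_subset[of \<sigma>] Union_upper[OF that] by (rule subset_trans)
  ultimately show ?thesis
    unfolding subdivide_def by (auto simp: Union_join Union_simplex)
qed

text \<open>In an effective weld the vertices of \<open>\<sigma>\<close> all lie on its non-empty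
  boundary, which is part of the link of \<open>a\<close>; hence none of them is new.\<close>

lemma Union_weld: "\<Union>(weld \<sigma> a A) \<subseteq> \<Union>A"
proof (cases rule: weld_cases[of \<sigma> a A])
  case (2 L)
  have "\<Union>(bdry \<sigma> \<star> L) \<subseteq> \<Union>A"
    using 2(4) unfolding weld_factor_def link_def by blast
  then have "\<sigma> \<union> \<Union>L \<subseteq> \<Union>A" using Union_bdry[OF 2(3)] by (simp add: Union_join)
  then show ?thesis using 2 by (auto simp: Union_join Union_simplex)
qed simp

lemma Union_apply_move:
  assumes "x \<in> \<Union>(apply_move d A)" "x \<notin> \<Union>A"
  shows "\<not> is_Weld d \<and> x = vertex d"
  using assms Union_subdivide[of "base d" "vertex d" A] Union_weld[of "base d" "vertex d" A]
  by (cases d) auto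

text \<open>A new vertex is created by the first move after which it occurs, and that move has to be
  a subdivision.\<close>

lemma Union_apply_moves:
  assumes "x \<in> \<Union>(apply_moves ds A)" "x \<notin> \<Union>A"
  obtains d where "d \<in> set ds" "\<not> is_Weld d" "x = vertex d"
  using assms
proof (induction ds arbitrary: A thesis)
  case Nil
  then show ?case by (simp add: apply_moves_def)
next
  case (Cons d ds)
  have *: "apply_moves (d # ds) A = apply_moves ds (apply_move d A)"
    by (simp add: apply_moves_def)
  show ?case
  proof (cases "x \<in> \<Union>(apply_move d A)")
    case True
    then show ?thesis using Union_apply_move Cons.prems by (metis list.set_intros(1))
  next
    case False
    then show ?thesis using Cons.IH Cons.prems * by (metis list.set_intros(2))
  qed
qed

section \<open>Moves on one factor of a join\<close>

text \<open>No face of \<open>B\<close> contains \<open>\<sigma>\<close>, so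
  \<open>\<sigma> \<union> \<tau>\<close> can only lie in \<open>X \<star> M\<close>. As
  \<open>\<sigma>\<close> avoids the vertices of \<open>M\<close>, the part of \<open>\<tau>\<close>
  inside \<open>M\<close> splits off as a join factor.\<close>

lemma link_join_Un:
  assumes X: "complex X" and M: "{} \<notin> M" and B0: "{} \<notin> B" and disj: "\<Union>X \<inter> \<Union>M = {}"
    and \<sigma>: "\<sigma> \<noteq> {}" "\<sigma> \<inter> \<Union>M = {}" "\<forall>\<beta>\<in>B. \<not> \<sigma> \<subseteq> \<beta>" "\<sigma> \<in> X"
  shows "link \<sigma> (X \<star> M \<union> B) = link \<sigma> X \<star> M"
proof (rule set_eqI)
  fix \<tau>
  let ?V = "\<Union>M"
  note split = in_join_iff_split[OF empty_notin_complex[OF X] M subset_refl disj]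
  have lk: "{} \<notin> link \<sigma> X" "\<Union>(link \<sigma> X) \<inter> ?V = {}"
    using empty_notin_complex[OF X] disj unfolding link_def by auto
  note split' = in_join_iff_split[OF lk(1) M subset_refl lk(2)]
  have eqs: "\<sigma> \<union> \<tau> - ?V = \<sigma> \<union> (\<tau> - ?V)" "(\<sigma> \<union> \<tau>) \<inter> ?V = \<tau> \<inter> ?V"
    using \<sigma>(2) by blast+
  have B: "\<sigma> \<union> \<tau> \<notin> B" using \<sigma>(3) by blast
  show "\<tau> \<in> link \<sigma> (X \<star> M \<union> B) \<longleftrightarrow> \<tau> \<in> link \<sigma> X \<star> M"
  proof
    assume "\<tau> \<in> link \<sigma> (X \<star> M \<union> B)"
    then have *: "\<tau> \<in> X \<star> M \<union> B" "\<tau> \<inter> \<sigma> = {}" "\<sigma> \<union> \<tau> \<in> X \<star> M"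
      using B unfolding link_def by auto
    then have **: "\<sigma> \<union> (\<tau> - ?V) \<in> X" "\<tau> \<inter> ?V \<in> insert {} M"
      unfolding split eqs using \<sigma>(1) by auto
    have "\<tau> - ?V \<in> insert {} (link \<sigma> X)"
      using **(1) *(2) complexD[OF X **(1), of "\<tau> - ?V"] unfolding link_def by blast
    moreover have "\<tau> \<noteq> {}"
      using *(1) B0 split by auto
    ultimately show "\<tau> \<in> link \<sigma> X \<star> M" unfolding split' using ** by blast
  next
    assume "\<tau> \<in> link \<sigma> X \<star> M"
    then have *: "\<tau> \<noteq> {}" "\<tau> - ?V \<in> insert {} (link \<sigma> X)" "\<tau> \<inter> ?V \<in> insert {} M"
      unfolding split' by auto
    \<comment> \<open>For \<open>\<rho> = {}\<close> this needs \<open>\<sigma> \<in> X\<close>;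
      that case covers the faces lying entirely in \<open>M\<close>.\<close>
    have "\<rho> \<in> insert {} X \<and> \<sigma> \<union> \<rho> \<in> X \<and> \<rho> \<inter> \<sigma> = {}" if "\<rho> \<in> insert {} (link \<sigma> X)" for \<rho>
      using that \<sigma>(4) unfolding link_def by auto
    from this[OF *(2)] have "\<tau> \<in> X \<star> M" "\<sigma> \<union> \<tau> \<in> X \<star> M" "\<tau> \<inter> \<sigma> = {}"
      unfolding split eqs using * \<sigma> by auto
    then show "\<tau> \<in> link \<sigma> (X \<star> M \<union> B)" unfolding link_def by blast
  qed
qed

text \<open>Whether a face of the join contains \<open>\<sigma>\<close> is decided by its part
  outside \<open>M\<close>, and no face of \<open>B\<close> is deleted.\<close>

lemma diff_star_join_Un:
  assumes X: "{} \<notin> X" and M: "{} \<notin> M" and disj: "\<Union>X \<inter> \<Union>M = {}"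
    and \<sigma>: "\<sigma> \<noteq> {}" "\<sigma> \<inter> \<Union>M = {}" "\<forall>\<beta>\<in>B. \<not> \<sigma> \<subseteq> \<beta>"
  shows "(X \<star> M \<union> B) - star \<sigma> (X \<star> M \<union> B) = (X - star \<sigma> X) \<star> M \<union> B"
proof (rule set_eqI)
  fix \<tau>
  let ?V = "\<Union>M"
  note split = in_join_iff_split[OF X M subset_refl disj]
  have X': "{} \<notin> X - star \<sigma> X" "\<Union>(X - star \<sigma> X) \<inter> ?V = {}" using X disj by blast+
  note split' = in_join_iff_split[OF X'(1) M subset_refl X'(2)]
  have sub: "\<sigma> \<subseteq> \<tau> \<longleftrightarrow> \<sigma> \<subseteq> \<tau> - ?V" using \<sigma>(2) by blast
  have "\<tau> \<in> X \<star> M \<and> \<not> \<sigma> \<subseteq> \<tau> \<longleftrightarrow> \<tau> \<in> (X - star \<sigma> X) \<star> M"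
    unfolding split split' sub using \<sigma>(1) by (auto simp: star_def)
  then show "\<tau> \<in> (X \<star> M \<union> B) - star \<sigma> (X \<star> M \<union> B) \<longleftrightarrow> \<tau> \<in> (X - star \<sigma> X) \<star> M \<union> B"
    using \<sigma>(3) unfolding star_def by blast
qed

lemma mem_join_Un_iff:
  assumes "{} \<notin> X" "{} \<notin> M" "\<sigma> \<noteq> {}" "\<sigma> \<inter> \<Union>M = {}" "\<sigma> \<notin> B"
  shows "\<sigma> \<in> X \<star> M \<union> B \<longleftrightarrow> \<sigma> \<in> X"
proof -
  have "\<mu> = {}" if "\<mu> \<in> insert {} M" "\<sigma> = \<rho> \<union> \<mu>" for \<rho> \<mu> using that assms(4) by blast
  then show ?thesis using assms(3,5) unfolding in_join_iff[OF assms(1,2)] Un_iff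
    by (metis insertE insertI1 insertI2 sup_bot_right)
qed

text \<open>The move is effective on the large complex exactly when it is on \<open>X\<close>. The
  link acquires the factor \<open>M\<close>, and associativity pulls this factor out of the inserted
  join.\<close>

lemma subdivide_join_Un:
  assumes X: "complex X" and M: "{} \<notin> M" and B: "{} \<notin> B" and disj: "\<Union>X \<inter> \<Union>M = {}"
    and \<sigma>: "\<sigma> \<noteq> {}" "\<sigma> \<inter> \<Union>M = {}" "\<forall>\<beta>\<in>B. \<not> \<sigma> \<subseteq> \<beta>"
    and a: "a \<notin> \<Union>M" "a \<notin> \<Union>B"
  shows "subdivide \<sigma> a (X \<star> M \<union> B) = subdivide \<sigma> a X \<star> M \<union> B"
proof -
  note X0 = empty_notin_complex[OF X]
  have mem: "\<sigma> \<in> X \<star> M \<union> B \<longleftrightarrow> \<sigma> \<in> X" using mem_join_Un_iff[OF X0 M \<sigma>(1,2)] \<sigma>(3) by blast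
  have vert: "a \<in> \<Union>(X \<star> M \<union> B) \<longleftrightarrow> a \<in> \<Union>X"
    using a by (simp only: Union_Un_distrib Union_join Un_iff simp_thms)
  have eq: "((X \<star> M \<union> B) - star \<sigma> (X \<star> M \<union> B)) \<union> (simplex {a} \<star> bdry \<sigma> \<star> link \<sigma> (X \<star> M \<union> B))
      = ((X - star \<sigma> X) \<union> (simplex {a} \<star> bdry \<sigma> \<star> link \<sigma> X)) \<star> M \<union> B" if "\<sigma> \<in> X"
    unfolding link_join_Un[OF X M B disj \<sigma> that] diff_star_join_Un[OF X0 M disj \<sigma>]
      join_Un_left join_assoc[symmetric] by (simp only: Un_ac)
  show ?thesis
  proof (cases "\<sigma> \<in> X \<and> a \<notin> \<Union>X")
    case True
    then show ?thesis unfolding subdivide_def mem vert by (simp only: eq simp_thms if_True)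
  next
    case False
    then show ?thesis unfolding subdivide_def mem vert by (simp only: if_False)
  qed
qed

text \<open>Effectiveness is transferred in both directions: a factor \<open>L\<close> for
  \<open>X\<close> yields \<open>L \<star> M\<close>, and a factor for the large complex is cut down
  to its faces that miss \<open>M\<close>.\<close>

lemma weld_join_Un:
  assumes X: "complex X" and M: "complex M" and B: "{} \<notin> B" and disj: "\<Union>X \<inter> \<Union>M = {}"
    and \<sigma>: "\<sigma> \<noteq> {}" "\<sigma> \<inter> \<Union>M = {}" "\<sigma> \<notin> B"
    and a: "a \<notin> \<Union>M" "a \<notin> \<Union>B"
  shows "weld \<sigma> a (X \<star> M \<union> B) = weld \<sigma> a X \<star> M \<union> B"
proof -
  let ?Y = "X \<star> M \<union> B"
  note X0 = empty_notin_complex[OF X] and M0 = empty_notin_complex[OF M]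
  have mem: "\<sigma> \<in> ?Y \<longleftrightarrow> \<sigma> \<in> X" using mem_join_Un_iff[OF X0 M0 \<sigma>] .
  have vert: "a \<in> \<Union>?Y \<longleftrightarrow> a \<in> \<Union>X"
    using a by (simp only: Union_Un_distrib Union_join Un_iff simp_thms)
  \<comment> \<open>A weld deletes the star of its vertex, so the link and deletion lemmas are
    applied to \<open>{a}\<close> in place of \<open>\<sigma>\<close>.\<close>
  have a': "{a} \<noteq> {}" "{a} \<inter> \<Union>M = {}" "\<forall>\<beta>\<in>B. \<not> {a} \<subseteq> \<beta>" using a by auto
  have aX: "{a} \<in> X" if "a \<in> \<Union>X" using that complexD[OF X] by blast
  note lk = link_join_Un[OF X M0 B disj a']
  have fac: "weld_factor \<sigma> a ?Y (L \<star> M)" if "weld_factor \<sigma> a X L" "a \<in> \<Union>X" for L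
  proof -
    have "\<Union>(bdry \<sigma>) \<inter> \<Union>M = {}" using \<sigma>(2) Union_bdry_subset[of \<sigma>] by blast
    then show ?thesis
      using that lk[OF aX] complex_join[OF _ M]
      unfolding weld_factor_def by (simp only: join_assoc Union_join Int_Un_distrib simp_thms Un_empty)
  qed
  have ex: "\<exists>L. weld_factor \<sigma> a X L" if L': "weld_factor \<sigma> a ?Y L'" and "a \<in> \<Union>X" for L'
  proof -
    \<comment> \<open>The link is both \<open>link {a} X \<star> M\<close> and
      \<open>bdry \<sigma> \<star> L'\<close>. Restricted to faces that miss \<open>M\<close>, these
      become \<open>link {a} X\<close> and \<open>bdry \<sigma> \<star> ?L\<close>, since the
      boundary misses \<open>M\<close> anyway.\<close>
    let ?L = "{\<tau> \<in> L'. \<tau> \<inter> \<Union>M = {}}"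
    have L: "complex L'" "\<Union>(bdry \<sigma>) \<inter> \<Union>L' = {}" "link {a} ?Y = bdry \<sigma> \<star> L'"
      using L' unfolding weld_factor_def by auto
    then have eq: "link {a} X \<star> M = bdry \<sigma> \<star> L'" using lk[OF aX[OF that(2)]] by simp
    have "\<tau> \<in> link {a} X \<longleftrightarrow> \<tau> \<in> link {a} X \<star> M \<and> \<tau> \<inter> \<Union>M = {}" for \<tau>
    proof -
      have lk0: "{} \<notin> link {a} X" "\<Union>(link {a} X) \<inter> \<Union>M = {}"
        using X0 disj unfolding link_def by auto
      have "\<tau> \<in> link {a} X \<star> M \<longleftrightarrow> \<tau> \<in> link {a} X" if "\<tau> \<inter> \<Union>M = {}"
        unfolding in_join_iff_split[OF lk0(1) M0 subset_refl lk0(2)] Diff_triv[OF that] that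
        using lk0(1) by auto
      moreover have "\<tau> \<inter> \<Union>M = {}" if "\<tau> \<in> link {a} X" using that lk0(2) by blast
      ultimately show ?thesis by blast
    qed
    moreover have "(\<tau> \<in> bdry \<sigma> \<star> L' \<and> \<tau> \<inter> \<Union>M = {}) \<longleftrightarrow> \<tau> \<in> bdry \<sigma> \<star> ?L" for \<tau>
    proof -
      have "\<rho> \<inter> \<Union>M = {}" if "\<rho> \<in> bdry \<sigma>" for \<rho>
        using that \<sigma>(2) Union_bdry_subset[of \<sigma>] by blast
      then show ?thesis unfolding join_def by (auto simp: Int_Un_distrib2)
    qed
    ultimately have "link {a} X = bdry \<sigma> \<star> ?L" using eq by (intro set_eqI) simp
    moreover have "complex ?L" using L(1) unfolding complex_def by blast
    ultimately have "weld_factor \<sigma> a X ?L" using L(2) unfolding weld_factor_def by blast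
    then show ?thesis ..
  qed
  show ?thesis
  proof (cases "\<sigma> \<notin> X \<and> a \<in> \<Union>X \<and> bdry \<sigma> \<noteq> {} \<and> (\<exists>L. weld_factor \<sigma> a X L)")
    case True
    then obtain L where L: "\<sigma> \<notin> X" "a \<in> \<Union>X" "bdry \<sigma> \<noteq> {}" "weld_factor \<sigma> a X L" by blast
    then have "weld \<sigma> a ?Y = (?Y - star {a} ?Y) \<union> (simplex \<sigma> \<star> (L \<star> M))"
      using fac mem vert by (intro weld_eq) auto
    also have "\<dots> = ((X - star {a} X) \<union> (simplex \<sigma> \<star> L)) \<star> M \<union> B"
      unfolding diff_star_join_Un[OF X0 M0 disj a'] join_Un_left join_assoc[symmetric]
      by (simp only: Un_ac)
    finally show ?thesis using weld_eq[OF L] by simp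
  next
    case False
    moreover have "\<not> (\<sigma> \<notin> ?Y \<and> a \<in> \<Union>?Y \<and> bdry \<sigma> \<noteq> {} \<and> (\<exists>L. weld_factor \<sigma> a ?Y L))"
      using False mem vert ex by blast
    ultimately show ?thesis unfolding weld_def by (simp only: if_False)
  qed
qed

text \<open>The hypotheses on a move persist, since a move adds at most its own vertex.\<close>

lemma apply_moves_join_Un:
  assumes "complex X" and M: "complex M" and B: "{} \<notin> B" and "\<Union>X \<inter> \<Union>M = {}"
    and "\<And>d. d \<in> set ds \<Longrightarrow> finite (base d) \<and> base d \<noteq> {} \<and> base d \<inter> \<Union>M = {} \<and>
      (\<forall>\<beta>\<in>B. \<not> base d \<subseteq> \<beta>) \<and> vertex d \<notin> \<Union>M \<and> vertex d \<notin> \<Union>B"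
  shows "apply_moves ds (X \<star> M \<union> B) = apply_moves ds X \<star> M \<union> B"
  using assms(1,4,5)
proof (induction ds arbitrary: X)
  case Nil
  then show ?case by (simp add: apply_moves_def)
next
  case (Cons d ds)
  have d: "finite (base d)" "base d \<noteq> {}" "base d \<inter> \<Union>M = {}" "\<forall>\<beta>\<in>B. \<not> base d \<subseteq> \<beta>"
    "vertex d \<notin> \<Union>M" "vertex d \<notin> \<Union>B"
    using Cons.prems(3)[of d] by simp_all
  have "apply_move d (X \<star> M \<union> B) = apply_move d X \<star> M \<union> B"
  proof (cases d)
    case (Subdivision \<sigma> a)
    then show ?thesis
      using subdivide_join_Un[OF Cons.prems(1) empty_notin_complex[OF M] B Cons.prems(2), of \<sigma> a] d
      by simp
  next
    case (Weld \<sigma> a)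
    then show ?thesis
      using weld_join_Un[OF Cons.prems(1) M B Cons.prems(2), of \<sigma> a] d by auto
  qed
  moreover have "complex (apply_move d X)"
    using complex_apply_move Cons.prems(1) d(1) by blast
  moreover have "\<Union>(apply_move d X) \<inter> \<Union>M = {}"
    using Union_apply_move[of _ d X] Cons.prems(2) d(5) by blast
  ultimately show ?case
    using Cons.IH[of "apply_move d X"] Cons.prems(3) by (simp add: apply_moves_def)
qed

section \<open>The intermediate complexes\<close>

lemma chain_subset: "subset.chain P K \<Longrightarrow> K \<subseteq> P"
  unfolding subset_chain_def by (rule conjunct1)

lemma chain_mono:
  assumes "subset.chain P K" "K' \<subseteq> K" "K' \<subseteq> P'"
  shows "subset.chain P' K'"
  using assms unfolding subset_chain_def by (meson subsetD)

text \<open>\<open>P\<close> holds the processed and \<open>T\<close> the pending complexes. They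
  are separate parameters because the untouched part \<open>stage v (S - T) (T - {C})\<close> leaves
  \<open>C\<close> out of both. Either of \<open>\<sigma>\<close> and \<open>K\<close> may be empty,
  but not both.\<close>

definition stage ::
    "('a set set \<Rightarrow> 'a) \<Rightarrow> 'a set set set \<Rightarrow> 'a set set set \<Rightarrow> 'a set set" where
  "stage v P T = {\<sigma> \<union> v ` K | \<sigma> K. \<sigma> \<union> v ` K \<noteq> {} \<and> subset.chain P K \<and>
     (\<sigma> = {} \<or> (\<exists>C\<in>T. \<sigma> \<in> C \<and> (\<forall>D\<in>K. C \<subseteq> D)))}"

text \<open>This is the factor \<open>M\<close>. It can be formed in all of \<open>S\<close>: when
  \<open>C\<close> is maximal among the pending complexes, everything strictly above it is
  processed.\<close>

definition upper :: "'a set set set \<Rightarrow> ('a set set \<Rightarrow> 'a) \<Rightarrow> 'a set set \<Rightarrow> 'a set set" where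
  "upper S v C = {v ` K | K. K \<noteq> {} \<and> subset.chain {D \<in> S. C \<subset> D} K}"

lemma stageI:
  assumes "\<tau> = \<sigma> \<union> v ` K" "\<tau> \<noteq> {}" "subset.chain P K"
    "\<sigma> = {} \<or> (\<exists>C\<in>T. \<sigma> \<in> C \<and> (\<forall>D\<in>K. C \<subseteq> D))"
  shows "\<tau> \<in> stage v P T"
  using assms unfolding stage_def by blast

lemma stageE:
  assumes "\<tau> \<in> stage v P T"
  obtains \<sigma> K where "\<tau> = \<sigma> \<union> v ` K" "\<tau> \<noteq> {}" "subset.chain P K"
    "\<sigma> = {} \<or> (\<exists>C\<in>T. \<sigma> \<in> C \<and> (\<forall>D\<in>K. C \<subseteq> D))"
  using assms unfolding stage_def by blast

text \<open>The empty chain accounts for the added empty face; \<open>in_join_iff\<close> calls for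
  the factor in this form.\<close>

lemma insert_empty_upper: "insert {} (upper S v C) = {v ` K | K. subset.chain {D \<in> S. C \<subset> D} K}"
  unfolding upper_def subset_chain_def by auto

lemma empty_notin_upper: "{} \<notin> upper S v C"
  unfolding upper_def by auto

lemma Union_upper_subset: "\<Union>(upper S v C) \<subseteq> v ` {D \<in> S. C \<subset> D}"
  unfolding upper_def subset_chain_def by auto

lemma Union_stage_subset: "\<Union>(stage v P T) \<subseteq> \<Union>(\<Union>T) \<union> v ` P"
  unfolding stage_def subset_chain_def by auto

lemma complex_upper:
  assumes "finite S"
  shows "complex (upper S v C)"
proof -
  have "\<tau>' \<in> upper S v C" if \<tau>: "\<tau> \<in> upper S v C" "\<tau>' \<subseteq> \<tau>" "\<tau>' \<noteq> {}" for \<tau> \<tau>'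
  proof -
    from \<tau>(1) obtain K where K: "\<tau> = v ` K" "subset.chain {D \<in> S. C \<subset> D} K"
      unfolding upper_def by blast
    then obtain K' where K': "K' \<subseteq> K" "\<tau>' = v ` K'" using \<tau>(2) by (auto elim: subset_imageE)
    have "subset.chain {D \<in> S. C \<subset> D} K'"
      using K(2) K'(1) chain_subset[OF K(2)] by (blast intro: chain_mono)
    then show ?thesis using \<tau>(3) K'(2) unfolding upper_def by auto
  qed
  moreover have "finite \<tau> \<and> \<tau> \<noteq> {}" if "\<tau> \<in> upper S v C" for \<tau>
    using that assms finite_subset[of _ S] unfolding upper_def subset_chain_def by auto
  ultimately show ?thesis unfolding complex_def by blast
qed

text \<open>Finiteness of \<open>S\<close> comes from a linearization, which lists its members; it
  keeps the images of chains finite.\<close>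

locale finite_starred_system =
  fixes S :: "'a set set set" and \<delta> :: "'a set set \<Rightarrow> 'a move list" and v :: "'a set set \<Rightarrow> 'a"
  assumes finite_S: "finite S" and sys: "system S" and starring: "starring S \<delta> v"
begin

lemma complex_S: "C \<in> S \<Longrightarrow> complex C"
  using sys unfolding system_def by blast

lemma Int_in_S: "C \<in> S \<Longrightarrow> C' \<in> S \<Longrightarrow> \<sigma> \<in> C \<Longrightarrow> \<sigma> \<in> C' \<Longrightarrow> C \<inter> C' \<in> S"
  using sys unfolding system_def by blast

lemma concentrated_move:
  assumes "C \<in> S" "d \<in> set (\<delta> C)"
  shows "finite (base d)" "concentrated S C d"
  using starring assms unfolding starring_def by simp_all

lemma apply_moves_self:
  assumes "C \<in> S"
  shows "apply_moves (\<delta> C) C = simplex {v C} \<star> lower S C" "v C \<notin> \<Union>C"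
  using starring assms unfolding starring_def by simp_all

lemma inj_v: "inj_on v S"
  using starring unfolding starring_def by (intro inj_onI) metis

lemma free_from_moves:
  assumes "C \<in> S" "D \<in> S" "\<not> D \<subseteq> C" "d \<in> set (\<delta> C)" "d' \<in> set (\<delta> D)"
  shows "free_from d d'"
  using starring assms unfolding starring_def by simp

section \<open>Consequences of concentration and freeness\<close>

text \<open>\<open>v C\<close> is missing from \<open>C\<close> but present after
  \<open>\<delta> C\<close>, so some subdivision creates it. Freeness constrains the vertices of
  subdivisions and thereby applies to \<open>v C\<close>.\<close>

lemma v_is_subdivision_vertex:
  assumes "C \<in> S"
  obtains d where "d \<in> set (\<delta> C)" "\<not> is_Weld d" "v C = vertex d"
proof -
  have "v C \<in> \<Union>(apply_moves (\<delta> C) C)"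
    unfolding apply_moves_self(1)[OF assms] by (simp only: Union_join Union_simplex) simp
  then show ?thesis
    using apply_moves_self(2)[OF assms] by (rule Union_apply_moves) (rule that)
qed

lemma vertex_in_S:
  assumes "C \<in> S" "d \<in> set (\<delta> C)" "vertex d \<in> \<Union>(\<Union>S)"
  shows "{vertex d} \<in> C"
proof -
  from assms(3) obtain D \<tau> where "D \<in> S" "\<tau> \<in> D" "vertex d \<in> \<tau>" by blast
  then have "{vertex d} \<in> \<Union>S" using complexD[OF complex_S] by blast
  moreover have "{vertex d} \<in> simplex {vertex d} \<star> simplex (base d)"
    unfolding join_def simplex_def by auto
  ultimately show ?thesis using concentrated_move(2)[OF assms(1,2)] unfolding concentrated_def by blast
qed

lemma base_in_S:
  assumes "C \<in> S" "d \<in> set (\<delta> C)" "base d \<in> \<Union>S"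
  shows "base d \<in> C"
proof -
  have "base d \<noteq> {}" using concentrated_move(2)[OF assms(1,2)] unfolding concentrated_def by auto
  then have "base d \<in> simplex {vertex d} \<star> simplex (base d)"
    unfolding join_def simplex_def by auto
  then show ?thesis
    using concentrated_move(2)[OF assms(1,2)] assms(3) unfolding concentrated_def by blast
qed

text \<open>\<open>v C\<close> is the vertex of a move in \<open>\<delta> C\<close>; if it occurred
  in the system, concentration would place it in \<open>C\<close>.\<close>

lemma v_fresh:
  assumes "C \<in> S"
  shows "v C \<notin> \<Union>(\<Union>S)"
proof
  assume v: "v C \<in> \<Union>(\<Union>S)"
  obtain d where "d \<in> set (\<delta> C)" "v C = vertex d" using v_is_subdivision_vertex assms .
  then have "{v C} \<in> C" using vertex_in_S[OF assms] v by auto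
  then show False using apply_moves_self(2)[OF assms] by blast
qed

text \<open>Freeness is applied to the subdivision in \<open>\<delta> D\<close> that creates
  \<open>v D\<close>.\<close>

lemma v_avoids_moves:
  assumes "C \<in> S" "d \<in> set (\<delta> C)" "D \<in> S" "\<not> D \<subseteq> C"
  shows "v D \<noteq> vertex d" "v D \<notin> base d"
proof -
  obtain d' where d': "d' \<in> set (\<delta> D)" "\<not> is_Weld d'" "v D = vertex d'"
    using v_is_subdivision_vertex assms(3) .
  have "free_from d d'" using free_from_moves[OF assms(1,3,4,2) d'(1)] .
  then show "v D \<noteq> vertex d" "v D \<notin> base d" using d' unfolding free_from_def by auto
qed

text \<open>The intersection \<open>C \<inter> C'\<close> is non-empty, hence a member of
  \<open>S\<close>, and lies strictly below \<open>C\<close>.\<close>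

lemma mem_lower:
  assumes "C \<in> S" "C' \<in> S" "\<not> C \<subseteq> C'" "\<sigma> \<in> C" "\<sigma> \<in> C'"
  shows "\<sigma> \<in> lower S C"
  using Int_in_S[OF assms(1,2,4,5)] assms(3-5) unfolding lower_def by blast

section \<open>Transition from one stage to the next\<close>

text \<open>Faces with \<open>\<sigma>\<close> in \<open>C\<close> and \<open>K\<close> above
  \<open>C\<close> form the join; in any other face \<open>\<sigma>\<close> is empty or has a
  pending witness different from \<open>C\<close>.\<close>

lemma stage_split:
  assumes T: "C \<in> T" "T \<subseteq> S" "\<forall>D\<in>T. \<not> C \<subset> D"
  shows "stage v (S - T) T = C \<star> upper S v C \<union> stage v (S - T) (T - {C})"
proof -
  have C: "C \<in> S" using T by blast
  note join = in_join_iff[OF empty_notin_complex[OF complex_S[OF C]] empty_notin_upper[of S v C],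
      unfolded insert_empty_upper]
  show ?thesis
  proof (intro equalityI subsetI)
    fix \<tau> assume "\<tau> \<in> stage v (S - T) T"
    then obtain \<sigma> K where \<tau>: "\<tau> = \<sigma> \<union> v ` K" "\<tau> \<noteq> {}" "subset.chain (S - T) K"
      "\<sigma> = {} \<or> (\<exists>C\<in>T. \<sigma> \<in> C \<and> (\<forall>D\<in>K. C \<subseteq> D))"
      by (rule stageE)
    show "\<tau> \<in> C \<star> upper S v C \<union> stage v (S - T) (T - {C})"
    proof (cases "\<sigma> \<in> C \<and> (\<forall>D\<in>K. C \<subseteq> D)")
      case True
      \<comment> \<open>\<open>C\<close> is pending and therefore not in \<open>K\<close>, which
        makes the inclusions strict.\<close>
      then have "K \<subseteq> {D \<in> S. C \<subset> D}" using chain_subset[OF \<tau>(3)] T(1) by blast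
      then have "subset.chain {D \<in> S. C \<subset> D} K" using chain_mono[OF \<tau>(3) subset_refl] by blast
      then show ?thesis unfolding Un_iff join using True \<tau> by blast
    next
      case False
      then have "\<tau> \<in> stage v (S - T) (T - {C})" using \<tau> by (intro stageI[of \<tau> \<sigma> v K]) auto
      then show ?thesis ..
    qed
  next
    fix \<tau> assume "\<tau> \<in> C \<star> upper S v C \<union> stage v (S - T) (T - {C})"
    then show "\<tau> \<in> stage v (S - T) T"
    proof
      assume "\<tau> \<in> C \<star> upper S v C"
      then obtain \<sigma> K where \<tau>: "\<tau> \<noteq> {}" "\<sigma> \<in> insert {} C" "\<tau> = \<sigma> \<union> v ` K"
          "subset.chain {D \<in> S. C \<subset> D} K"
        unfolding join by blast
      have K: "K \<subseteq> S - T" "\<forall>D\<in>K. C \<subseteq> D"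
        using chain_subset[OF \<tau>(4)] T(3) by blast+
      moreover have "subset.chain (S - T) K" using chain_mono[OF \<tau>(4) subset_refl K(1)] .
      ultimately show ?thesis using T(1) \<tau>(1-3) by (intro stageI[of \<tau> \<sigma> v K]) auto
    next
      assume "\<tau> \<in> stage v (S - T) (T - {C})"
      then show ?thesis unfolding stage_def by blast
    qed
  qed
qed

text \<open>Faces are sorted by whether \<open>C\<close> belongs to the chain. If it does,
  \<open>\<sigma>\<close> comes from strictly below \<open>C\<close> and the rest of the chain lies
  strictly above; if not, the face belongs to the untouched part.\<close>

lemma stage_remove:
  assumes T: "C \<in> T" "T \<subseteq> S" "\<forall>D\<in>T. \<not> C \<subset> D" "\<forall>D\<in>S. D \<subset> C \<longrightarrow> D \<in> T"
  shows "stage v (S - (T - {C})) (T - {C}) =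
    (simplex {v C} \<star> lower S C) \<star> upper S v C \<union> stage v (S - T) (T - {C})"
proof -
  let ?P = "S - (T - {C})"
  have C: "C \<in> S" using T by blast
  have low0: "{} \<notin> lower S C"
    using complex_S empty_notin_complex unfolding lower_def by blast
  have sim0: "{} \<notin> simplex {v C}" unfolding simplex_def by blast
  have ins: "insert {} (simplex {v C}) = {{}, {v C}}" unfolding simplex_def by auto
  note join1 = in_join_iff[OF sim0 low0, unfolded ins]
  have sl0: "{} \<notin> simplex {v C} \<star> lower S C" unfolding join1 by blast
  note join = in_join_iff[OF sl0 empty_notin_upper[of S v C], unfolded insert_empty_upper]
  show ?thesis
  proof (intro equalityI subsetI)
    fix \<tau> assume "\<tau> \<in> stage v ?P (T - {C})"
    then obtain \<sigma> K where \<tau>: "\<tau> = \<sigma> \<union> v ` K" "\<tau> \<noteq> {}" "subset.chain ?P K"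
      "\<sigma> = {} \<or> (\<exists>C'\<in>T - {C}. \<sigma> \<in> C' \<and> (\<forall>D\<in>K. C' \<subseteq> D))"
      by (rule stageE)
    show "\<tau> \<in> (simplex {v C} \<star> lower S C) \<star> upper S v C \<union> stage v (S - T) (T - {C})"
    proof (cases "C \<in> K")
      case True
      \<comment> \<open>Everything strictly below \<open>C\<close> is pending, so the other elements
        of the chain, being comparable to \<open>C\<close>, lie above it.\<close>
      have "K - {C} \<subseteq> {D \<in> S. C \<subset> D}"
      proof
        fix D assume D: "D \<in> K - {C}"
        then have "D \<subseteq> C \<or> C \<subseteq> D" using \<tau>(3) True unfolding subset_chain_def by simp
        then show "D \<in> {D \<in> S. C \<subset> D}" using chain_subset[OF \<tau>(3)] D T(4) by blast
      qed
      then have "subset.chain {D \<in> S. C \<subset> D} (K - {C})"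
        using chain_mono[OF \<tau>(3) Diff_subset] by blast
      moreover have "\<sigma> \<in> insert {} (lower S C)"
        using \<tau>(4) True T(2) unfolding lower_def by blast
      then have "{v C} \<union> \<sigma> \<in> simplex {v C} \<star> lower S C" unfolding join1 by blast
      moreover have "\<tau> = ({v C} \<union> \<sigma>) \<union> v ` (K - {C})" using \<tau>(1) True by blast
      ultimately show ?thesis unfolding Un_iff join using \<tau>(2) by blast
    next
      case False
      then have "K \<subseteq> S - T" using chain_subset[OF \<tau>(3)] by blast
      then have "subset.chain (S - T) K" using chain_mono[OF \<tau>(3) subset_refl] by blast
      then have "\<tau> \<in> stage v (S - T) (T - {C})" using \<tau> by (intro stageI[of \<tau> \<sigma> v K])
      then show ?thesis ..
    qed
  next
    fix \<tau> assume "\<tau> \<in> (simplex {v C} \<star> lower S C) \<star> upper S v C \<union> stage v (S - T) (T - {C})"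
    then show "\<tau> \<in> stage v ?P (T - {C})"
    proof
      assume "\<tau> \<in> (simplex {v C} \<star> lower S C) \<star> upper S v C"
      then obtain \<rho> K where \<tau>: "\<tau> \<noteq> {}" "\<rho> \<in> insert {} (simplex {v C} \<star> lower S C)" "\<tau> = \<rho> \<union> v ` K"
          "subset.chain {D \<in> S. C \<subset> D} K"
        unfolding join by blast
      from \<tau>(2) obtain \<epsilon> \<sigma> where \<epsilon>: "\<epsilon> \<in> {{}, {v C}}" "\<sigma> \<in> insert {} (lower S C)" "\<rho> = \<epsilon> \<union> \<sigma>"
        unfolding insert_iff[of \<rho>] join1 by blast
      \<comment> \<open>\<open>E\<close> records whether \<open>C\<close> joins the chain; its image
        under \<open>v\<close> is \<open>\<epsilon>\<close>.\<close>
      define E where "E = (if \<epsilon> = {} then {} else {C})"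
      have \<rho>: "E \<subseteq> {C}" "\<sigma> \<in> insert {} (lower S C)" "\<rho> = v ` E \<union> \<sigma>"
        using \<epsilon> by (auto simp: E_def)
      have K: "K \<subseteq> {D \<in> S. C \<subset> D}" by (rule chain_subset[OF \<tau>(4)])
      then have EK: "E \<union> K \<subseteq> ?P" "\<forall>D\<in>E \<union> K. C \<subseteq> D" using \<rho>(1) C T(3) by blast+
      have "X \<subseteq> Y \<or> Y \<subseteq> X" if "X \<in> E \<union> K" "Y \<in> E \<union> K" for X Y
      proof (cases "X \<in> E \<or> Y \<in> E")
        case True
        then show ?thesis using \<rho>(1) EK(2) that by blast
      next
        case False
        then show ?thesis using that \<tau>(4) unfolding subset_chain_def by simp
      qed
      with EK have "subset.chain ?P (E \<union> K)" "\<forall>D\<in>E \<union> K. C \<subseteq> D"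
        unfolding subset_chain_def by simp_all
      moreover have "\<exists>C'\<in>T - {C}. \<sigma> \<in> C' \<and> C' \<subseteq> C" if "\<sigma> \<noteq> {}"
        using \<rho>(2) that T(4) unfolding lower_def by blast
      moreover have "\<tau> = \<sigma> \<union> v ` (E \<union> K)" using \<tau>(3) \<rho>(3) by blast
      ultimately show ?thesis using \<tau>(1) by (intro stageI[of \<tau> \<sigma> v "E \<union> K"]) blast+
    next
      assume "\<tau> \<in> stage v (S - T) (T - {C})"
      moreover have "subset.chain ?P K" if "subset.chain (S - T) K" for K
        using chain_mono[OF that subset_refl, of ?P] chain_subset[OF that] by blast
      ultimately show ?thesis unfolding stage_def by blast
    qed
  qed
qed

text \<open>The join lemma is applied with \<open>C\<close> as the moving factor. Freeness keeps the
  moves off the vertices \<open>v D\<close> of processed \<open>D\<close>, and concentration keeps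
  them off the faces of other pending complexes.\<close>

lemma apply_moves_stage:
  assumes T: "C \<in> T" "T \<subseteq> S" "\<forall>D\<in>T. \<not> C \<subset> D" "\<forall>D\<in>S. D \<subset> C \<longrightarrow> D \<in> T"
  shows "apply_moves (\<delta> C) (stage v (S - T) T) = stage v (S - (T - {C})) (T - {C})"
proof -
  let ?B = "stage v (S - T) (T - {C})"
  have C: "C \<in> S" using T by blast
  \<comment> \<open>\<open>C\<close> and everything below it are pending. This is the non-inclusion
    under which freeness is available.\<close>
  have ncont: "\<not> D \<subseteq> C" if "D \<in> S - T" for D using that T(1,4) by blast
  have "apply_moves (\<delta> C) (C \<star> upper S v C \<union> ?B) = apply_moves (\<delta> C) C \<star> upper S v C \<union> ?B"
  proof (rule apply_moves_join_Un[OF complex_S[OF C] complex_upper[OF finite_S]])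
    show "{} \<notin> ?B" unfolding stage_def by blast
    show "\<Union>C \<inter> \<Union>(upper S v C) = {}"
      using Union_upper_subset[of S v C] v_fresh C by blast
    fix d assume d: "d \<in> set (\<delta> C)"
    note conc = concentrated_move(2)[OF C d, unfolded concentrated_def]
    have base0: "base d \<noteq> {}" using conc by auto
    have up: "x \<notin> \<Union>(upper S v C)" if "x \<in> insert (vertex d) (base d)" for x
    proof
      assume "x \<in> \<Union>(upper S v C)"
      then obtain D where "D \<in> S" "C \<subset> D" "x = v D" using Union_upper_subset[of S v C] by blast
      then show False using that v_avoids_moves[OF C d, of D] by auto
    qed
    have avoid: "vertex d \<noteq> v D \<and> v D \<notin> base d" if "D \<in> S - T" for D
      using v_avoids_moves[OF C d, of D] ncont[OF that] that by auto
    \<comment> \<open>A vertex shared with another pending \<open>D\<close> would give a face of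
      \<open>C \<inter> D\<close>, hence a vertex of \<open>lower S C\<close>, which concentration
      forbids.\<close>
    have vB: "vertex d \<notin> \<Union>?B"
    proof
      assume "vertex d \<in> \<Union>?B"
      moreover have "vertex d \<notin> v ` (S - T)" using avoid by blast
      ultimately obtain D \<tau> where D: "D \<in> T - {C}" "\<tau> \<in> D" "vertex d \<in> \<tau>"
        using Union_stage_subset[of v "S - T" "T - {C}"] by blast
      then have "{vertex d} \<in> D" "{vertex d} \<in> C"
        using complexD[OF complex_S, of D \<tau>] vertex_in_S[OF C d] T(2) by blast+
      then have "{vertex d} \<in> lower S C" using mem_lower[OF C, of D] D(1) T(2,3) by blast
      then show False using conc by blast
    qed
    have bB: "\<not> base d \<subseteq> \<beta>" if \<beta>: "\<beta> \<in> ?B" for \<beta>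
    proof
      assume sub: "base d \<subseteq> \<beta>"
      from \<beta> obtain \<sigma> K where \<sigma>: "\<beta> = \<sigma> \<union> v ` K" "subset.chain (S - T) K"
        "\<sigma> = {} \<or> (\<exists>C'\<in>T - {C}. \<sigma> \<in> C' \<and> (\<forall>D\<in>K. C' \<subseteq> D))"
        by (rule stageE)
      \<comment> \<open>Without the vertices \<open>v D\<close>, a base contained in
        \<open>\<beta>\<close> lies in \<open>\<sigma>\<close>, and the intersection argument
        applies again, now to the base.\<close>
      have "base d \<inter> v ` K = {}"
        using avoid chain_subset[OF \<sigma>(2)] by blast
      then have "base d \<subseteq> \<sigma>" using sub \<sigma>(1) by blast
      then obtain D where D: "D \<in> T - {C}" "\<sigma> \<in> D" using base0 \<sigma>(3) by blast
      then have "base d \<in> D"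
        using complexD[OF complex_S D(2) \<open>base d \<subseteq> \<sigma>\<close> base0] T(2) by blast
      moreover from this have "base d \<in> C" using base_in_S[OF C d] D(1) T(2) by blast
      ultimately have "base d \<in> lower S C" using mem_lower[OF C, of D] D(1) T(2,3) by blast
      then show False using conc by blast
    qed
    show "finite (base d) \<and> base d \<noteq> {} \<and> base d \<inter> \<Union>(upper S v C) = {} \<and>
      (\<forall>\<beta>\<in>?B. \<not> base d \<subseteq> \<beta>) \<and> vertex d \<notin> \<Union>(upper S v C) \<and> vertex d \<notin> \<Union>?B"
      using concentrated_move(1)[OF C d] base0 up vB bB by blast
  qed
  then show ?thesis
    unfolding apply_moves_self(1)[OF C] stage_split[OF T(1-3)] stage_remove[OF T] by simp
qed

section \<open>Iteration along a linearization\<close>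

text \<open>The invariant is that the remaining list is closed downwards in \<open>S\<close>, with
  its head maximal among the remaining members.\<close>

lemma apply_moves_concat_stage:
  assumes "distinct Cs" "set Cs \<subseteq> S" "sorted_wrt (\<lambda>C D. \<not> C \<subset> D) Cs"
    "\<forall>C\<in>set Cs. \<forall>D\<in>S. D \<subset> C \<longrightarrow> D \<in> set Cs"
  shows "apply_moves (concat (map \<delta> Cs)) (stage v (S - set Cs) (set Cs)) = stage v S {}"
  using assms
proof (induction Cs)
  case Nil
  then show ?case by (simp add: apply_moves_def)
next
  case (Cons C Cs)
  have max: "\<forall>D\<in>set (C # Cs). \<not> C \<subset> D" using Cons.prems(3) by simp
  have down: "\<forall>D\<in>S. D \<subset> C \<longrightarrow> D \<in> set (C # Cs)" using Cons.prems(4) by simp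
  have rest: "set (C # Cs) - {C} = set Cs" using Cons.prems(1) by auto
  have "apply_moves (\<delta> C) (stage v (S - set (C # Cs)) (set (C # Cs))) = stage v (S - set Cs) (set Cs)"
    using apply_moves_stage[OF list.set_intros(1) Cons.prems(2) max down] unfolding rest .
  then have "apply_moves (concat (map \<delta> (C # Cs))) (stage v (S - set (C # Cs)) (set (C # Cs)))
      = apply_moves (concat (map \<delta> Cs)) (stage v (S - set Cs) (set Cs))"
    unfolding apply_moves_def by (simp only: list.map concat.simps fold_append o_apply)
  also have "\<dots> = stage v S {}"
  proof (rule Cons.IH)
    show "\<forall>C\<in>set Cs. \<forall>D\<in>S. D \<subset> C \<longrightarrow> D \<in> set Cs"
    proof (intro ballI impI)
      fix C' D assume "C' \<in> set Cs" "D \<in> S" "D \<subset> C'"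
      \<comment> \<open>\<open>D\<close> is not the head \<open>C\<close>, as the head is not
        strictly contained in any listed complex.\<close>
      moreover from this have "D \<in> set (C # Cs)" using Cons.prems(4) by simp
      ultimately show "D \<in> set Cs" using max by auto
    qed
  qed (use Cons.prems in simp_all)
  finally show ?case .
qed

text \<open>With nothing processed, only the empty chain is available and the stage is
  \<open>\<Union>S\<close>; with nothing pending, \<open>\<sigma>\<close> is empty and only images
  of chains remain.\<close>

lemma apply_linearization:
  assumes "linearization S \<delta> ds"
  shows "apply_moves ds (\<Union>S) = {v ` K | K. K \<in> chain_complex S}"
proof -
  obtain Cs where Cs: "distinct Cs" "set Cs = S" "ds = concat (map \<delta> Cs)"
    and order: "\<forall>i<length Cs. \<forall>j<length Cs. Cs ! i \<subset> Cs ! j \<longrightarrow> j < i"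
    using assms unfolding linearization_def by blast
  have "sorted_wrt (\<lambda>C D. \<not> C \<subset> D) Cs"
    unfolding sorted_wrt_iff_nth_less using order by (meson dual_order.strict_trans less_asym)
  then have "apply_moves ds (stage v {} S) = stage v S {}"
    using apply_moves_concat_stage[of Cs] Cs by simp
  moreover have "stage v {} S = \<Union>S"
    using complex_S empty_notin_complex unfolding stage_def subset_chain_def by auto
  moreover have "stage v S {} = {v ` K | K. K \<in> chain_complex S}"
    using finite_subset[OF _ finite_S] unfolding stage_def chain_complex_def subset_chain_def by auto
  ultimately show ?thesis by simp
qed

end

theorem theorem5p6:
  fixes S :: "'a set set set"
    and \<delta> :: "'a set set \<Rightarrow> 'a move list"
    and v :: "'a set set \<Rightarrow> 'a"
    and ds :: "'a move list"
  assumes "system S"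
    and "induced S"
    and "starring S \<delta> v"
    and "linearization S \<delta> ds"
  shows "vdom (apply_moves ds (\<Union>S)) = v ` S \<and>
         complex_iso (the_inv_into S v) (apply_moves ds (\<Union>S)) (chain_complex S)"
proof -
  have "finite S" using assms(4) unfolding linearization_def by auto
  then interpret finite_starred_system S \<delta> v using assms by unfold_locales
  let ?A = "apply_moves ds (\<Union>S)" and ?f = "the_inv_into S v"
  note A = apply_linearization[OF assms(4)]
  have sub: "K \<subseteq> S" if "K \<in> chain_complex S" for K
    using that unfolding chain_complex_def subset_chain_def by blast
  have sing: "{C} \<in> chain_complex S" if "C \<in> S" for C
    using that unfolding chain_complex_def subset_chain_def by blast
  have dom_chain: "\<Union>(chain_complex S) = S" using sub sing by blast
  have dom: "\<Union>?A = v ` S"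
  proof
    show "\<Union>?A \<subseteq> v ` S" unfolding A using sub by blast
    have "v ` {C} \<in> ?A" if "C \<in> S" for C unfolding A using sing[OF that] by blast
    then show "v ` S \<subseteq> \<Union>?A" by blast
  qed
  have bij: "bij_betw ?f (\<Union>?A) (\<Union>(chain_complex S))"
    unfolding dom dom_chain using inj_v by (simp add: bij_betw_the_inv_into inj_on_imp_bij_betw)
  have "\<sigma> \<in> ?A \<longleftrightarrow> ?f ` \<sigma> \<in> chain_complex S" if \<sigma>: "\<sigma> \<subseteq> \<Union>?A" for \<sigma>
  proof -
    have inv: "?f ` v ` K = K" if "K \<subseteq> S" for K
      using that the_inv_into_f_f[OF inj_v] by (force simp: image_image)
    from \<sigma> obtain K where K: "K \<subseteq> S" "\<sigma> = v ` K" unfolding dom by (auto elim: subset_imageE)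
    \<comment> \<open>Since \<open>v\<close> is injective, a face determines the chain of which it
      is the image.\<close>
    have "K' = K" if "K' \<in> chain_complex S" "\<sigma> = v ` K'" for K'
      using inv[OF K(1)] inv[OF sub[OF that(1)]] K(2) that(2) by simp
    then have "\<sigma> \<in> ?A \<longleftrightarrow> K \<in> chain_complex S" unfolding A using K(2) by blast
    then show ?thesis using inv[OF K(1)] K(2) by simp
  qed
  with bij dom show ?thesis unfolding complex_iso_def by blast
qed

end
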